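(* Let $X$ be a compact metric space. A family of probability measures $\Xi\subset\mathcal{M}(X)$ is setwisely relatively compact if and only if for any sequence $\{\nu_n\}_{n=1}^\infty\subset\Xi$ there is a subsequence $\{\nu_{n_i}\}_{i=1}^\infty$ such that $$\limsup_{i\to\infty}\nu_{n_i}(U)=\sup_{K\subset U,\ K\text{ closed}}\ \limsup_{i\to\infty}\nu_{n_i}(K)$$ for any open set $U\subset X$.
   Context: $\mathcal{M}(X)$ denotes the set of all probability measures on $(X,\mathcal{B})$, where $\mathcal{B}$ is the Borel $\sigma$-algebra of $X$. A sequence $\{\nu_n\}\subset\mathcal{M}(X)$ converges setwisely to $\nu\in\mathcal{M}(X)$ if $\lim_{n\to\infty}\nu_n(A)=\nu(A)$ for every $A\in\mathcal{B}$. A family $\Xi\subset\mathcal{M}(X)$ is setwisely relatively compact if every sequence in $\Xi$ has a subsequence converging setwisely to some measure in $\mathcal{M}(X)$ (the limit is not required to lie in $\Xi$). *)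

theory Defs
  imports "HOL-Probability.Probability"
begin

definition borel_prob_measures :: "'a::topological_space measure set" where
  "borel_prob_measures = {\<mu>. prob_space \<mu> \<and> sets \<mu> = sets borel}"

definition setwise_converges ::
    "(nat \<Rightarrow> 'a::topological_space measure) \<Rightarrow> 'a measure \<Rightarrow> bool" where
  "setwise_converges \<nu> \<mu> \<longleftrightarrow>
     (\<forall>A\<in>sets borel. (\<lambda>n. emeasure (\<nu> n) A) \<longlonglongrightarrow> emeasure \<mu> A)"

definition setwise_relatively_compact :: "'a::topological_space measure set \<Rightarrow> bool" where
  "setwise_relatively_compact \<Xi> \<longleftrightarrow>
     (\<forall>\<nu>. (\<forall>n. \<nu> n \<in> \<Xi>) \<longrightarrow>
        (\<exists>r :: nat \<Rightarrow> nat. strict_mono r \<and>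
           (\<exists>\<mu>\<in>borel_prob_measures. setwise_converges (\<lambda>i. \<nu> (r i)) \<mu>)))"

end

theory Submission
  imports Defs "HOL-Complex_Analysis.Great_Picard"
begin

text \<open>
  The crucial step of the converse is that a family with the stated property is uniformly
  continuous along every increasing sequence of open sets \<open>U\<^sub>k\<close> with union \<open>U\<close>. Otherwise there are
  \<open>\<nu>\<^sub>k\<close> in the family with \<open>\<nu>\<^sub>k (U - U\<^sub>k) > e\<close>; after passing to a subsequence, \<open>\<nu>\<^sub>k (U\<^sub>m)\<close>
  converges to some \<open>a\<^sub>m\<close> for every \<open>m\<close>, and this survives the further subsequence of the
  hypothesis. A closed \<open>K \<subseteq> U\<close> is compact, hence lies in some \<open>U\<^sub>m\<close>, so its upper limit is at most
  \<open>a\<^sub>m\<close>, whereas the upper limit of \<open>U\<close> is at least \<open>a\<^sub>m + e\<close>; this contradicts the hypothesis.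

  It follows that every Borel set is approximated by closed and open sets uniformly over the family.
  Hence the family is uniformly countably additive, and setwise convergence needs to be checked only
  on a countable base of the topology that is closed under finite unions, where it is obtained by a
  diagonal argument. The direct implication is inner regularity of the limit measure.
\<close>

section \<open>Topology: closed exhaustions, compactness, and a countable base\<close>

text \<open>The union of the interiors is recorded beside that of the closed sets because uniform
  continuity over the family will be known along increasing open sets only: it is applied to the
  interiors and then transferred to the larger \<open>K k\<close>.\<close>

lemma open_eq_Union_interior_closed:
  fixes U :: "'a::metric_space set"
  assumes "open U"
  obtains K :: "nat \<Rightarrow> 'a set"
  where "\<And>k. closed (K k)" "incseq K" "(\<Union>k. interior (K k)) = U" "(\<Union>k. K k) = U"
proof -
  \<comment> \<open>\<open>K k\<close> consists of the points at distance at least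
    \<open>1 / Suc k\<close> from every point outside \<open>U\<close>. If a ball of radius
    \<open>e\<close> around \<open>x\<close> lies in \<open>U\<close>, the ball of radius
    \<open>e/2\<close> lies in \<open>K k\<close> once \<open>1 / Suc k < e/2\<close>.\<close>
  define K where "K k = - (\<Union>y\<in>-U. ball y (1 / real (Suc k)))" for k
  have closed: "closed (K k)" for k
    unfolding K_def by (intro closed_Compl open_UN) auto
  have incseq: "incseq K"
  proof (rule incseq_SucI)
    fix k
    have "1 / real (Suc (Suc k)) \<le> 1 / real (Suc k)" by (simp add: frac_le)
    then show "K k \<le> K (Suc k)"
      unfolding K_def using subset_ball by blast
  qed
  have sub: "K k \<subseteq> U" for k
    unfolding K_def by (force intro: centre_in_ball[THEN iffD2])
  have cover: "\<exists>k. x \<in> interior (K k)" if x: "x \<in> U" for x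
  proof -
    obtain e where e: "e > 0" "ball x e \<subseteq> U"
      using assms x by (meson open_contains_ball)
    obtain k where k: "1 / real (Suc k) < e / 2"
      using e(1) nat_approx_posE by (metis half_gt_zero)
    have "ball x (e/2) \<subseteq> K k"
    proof (rule subsetI, rule ccontr)
      fix z assume z: "z \<in> ball x (e/2)" and "z \<notin> K k"
      then obtain y where y: "y \<notin> U" and zy: "dist y z < 1 / real (Suc k)"
        by (auto simp: K_def)
      have "dist x y \<le> dist x z + dist y z" by (rule dist_triangle2)
      also have "\<dots> < e" using z zy k by simp
      finally show False using e(2) y by auto
    qed
    then have "x \<in> interior (K k)"
      using e(1) by (meson centre_in_ball half_gt_zero interior_maximal open_ball subsetD)
    then show ?thesis by blast
  qed
  have "interior (K k) \<subseteq> K k" for k by (rule interior_subset)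
  with sub cover have "(\<Union>k. interior (K k)) = U" "(\<Union>k. K k) = U"
    by (auto simp: subset_iff) metis+
  then show thesis by (intro that[of K] closed incseq)
qed

lemma compact_subset_incseq_open:
  fixes U :: "nat \<Rightarrow> 'a::topological_space set"
  assumes "compact K" "\<And>k. open (U k)" "incseq U" "K \<subseteq> (\<Union>k. U k)"
  obtains m where "K \<subseteq> U m"
proof -
  obtain F where F: "finite F" "K \<subseteq> (\<Union>k\<in>F. U k)"
    using compactE_image[OF assms(1), of UNIV U] assms by auto
  obtain m where "F \<subseteq> {..m}"
    using F(1) finite_nat_iff_bounded_le by blast
  then have "U k \<subseteq> U m" if "k \<in> F" for k
    using that by (intro incseqD[OF \<open>incseq U\<close>]) auto
  then have "K \<subseteq> U m" using F(2) by blast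
  then show thesis using that by blast
qed

text \<open>Total boundedness gives finite nets of radius \<open>1 / Suc n\<close>, hence countably
  many balls that form a base. A closed \<open>K\<close> is compact, so finitely many of these balls
  inside \<open>U\<close> cover it; the finite unions of balls are therefore the required
  sets.\<close>

lemma compact_space_countable_base_interpolates:
  assumes "compact (UNIV :: 'a::metric_space set)"
  obtains \<B> :: "'a::metric_space set set"
  where "countable \<B>" "\<And>B. B \<in> \<B> \<Longrightarrow> open B"
    "\<And>K U. closed K \<Longrightarrow> open U \<Longrightarrow> K \<subseteq> U \<Longrightarrow> \<exists>B\<in>\<B>. K \<subseteq> B \<and> B \<subseteq> U"
proof -
  have "\<exists>F::'a set. finite F \<and> UNIV \<subseteq> (\<Union>x\<in>F. ball x (1 / real (Suc n)))" for n
    using assms unfolding compact_eq_totally_bounded by simp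
  then obtain F where F: "\<And>n. finite (F n)" "\<And>n. (UNIV::'a set) \<subseteq> (\<Union>x\<in>F n. ball x (1 / real (Suc n)))"
    by metis
  define \<C> where "\<C> = (\<Union>n. (\<lambda>x. ball x (1 / real (Suc n))) ` F n)"
  have "countable \<C>"
    unfolding \<C>_def using F(1) by (intro countable_UN) (auto intro: countable_finite)
  show thesis
  proof
    show "countable (\<Union> ` {\<D>. finite \<D> \<and> \<D> \<subseteq> \<C>})"
      using \<open>countable \<C>\<close> by (intro countable_image countable_Collect_finite_subset)
    show "open B" if "B \<in> \<Union> ` {\<D>. finite \<D> \<and> \<D> \<subseteq> \<C>}" for B
      using that by (auto simp: \<C>_def)
    show "\<exists>B\<in>\<Union> ` {\<D>. finite \<D> \<and> \<D> \<subseteq> \<C>}. K \<subseteq> B \<and> B \<subseteq> U"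
      if K: "closed K" and U: "open U" "K \<subseteq> U" for K U
    proof -
      have "compact K" using K assms by (metis compact_Int_closed inf_top_left)
      moreover have "K \<subseteq> \<Union> {C\<in>\<C>. C \<subseteq> U}"
      proof
        fix x assume "x \<in> K"
        then obtain e where e: "e > 0" "ball x e \<subseteq> U"
          using U by (meson open_contains_ball subsetD)
        obtain n where n: "1 / real (Suc n) < e / 2"
          using e(1) nat_approx_posE by (metis half_gt_zero)
        obtain c where c: "c \<in> F n" "x \<in> ball c (1 / real (Suc n))" using F(2) by blast
        have "ball c (1 / real (Suc n)) \<subseteq> ball x e"
        proof
          fix z assume z: "z \<in> ball c (1 / real (Suc n))"
          have "dist x z \<le> dist c x + dist c z" by (rule dist_triangle3)
          also have "\<dots> < e" using z c(2) n by simp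
          finally show "z \<in> ball x e" by simp
        qed
        then show "x \<in> \<Union> {C\<in>\<C>. C \<subseteq> U}" using c e unfolding \<C>_def by blast
      qed
      ultimately obtain \<D> where "\<D> \<subseteq> {C\<in>\<C>. C \<subseteq> U}" "finite \<D>" "K \<subseteq> \<Union>\<D>"
        by (rule compactE) (auto simp: \<C>_def)
      then show ?thesis by (intro bexI[of _ "\<Union>\<D>"]) auto
    qed
  qed
qed

section \<open>Diagonal subsequences\<close>

text \<open>The diagonal argument is \<open>function_convergent_subsequence\<close>, applied to the
  measures as functions on the countable family \<open>S\<close>, which are uniformly bounded by
  1.\<close>

lemma measures_convergent_subsequence:
  assumes "\<And>n. prob_space (\<nu> n)" "countable S"
  obtains r :: "nat \<Rightarrow> nat"
  where "strict_mono r" "\<And>A. A \<in> S \<Longrightarrow> convergent (\<lambda>i. measure (\<nu> (r i)) A)"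
proof (rule function_convergent_subsequence[OF assms(2), of "\<lambda>n. measure (\<nu> n)" 1])
  show "norm (measure (\<nu> n) A) \<le> 1" for n A
    using prob_space.prob_le_1[OF assms(1)] by simp
qed (use that in \<open>auto simp: convergent_def\<close>)

section \<open>Families uniformly continuous along increasing open sets\<close>

text \<open>A single index \<open>k\<close> suffices in the second assumption: the sets left over
  shrink as \<open>k\<close> grows, so the bound persists at all later indices and expresses uniform
  convergence to 0.\<close>

locale uniformly_open_continuous =
  fixes \<Xi> :: "'a::metric_space measure set"
  assumes borel_prob: "\<Xi> \<subseteq> borel_prob_measures"
    and uniformly_open: "\<And>U e. (\<And>k. open (U k)) \<Longrightarrow> incseq U \<Longrightarrow> 0 < e \<Longrightarrow>
      \<exists>k::nat. \<forall>\<nu>\<in>\<Xi>. measure \<nu> ((\<Union>k. U k) - U k) \<le> (e::real)"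
begin

lemma prob: "\<nu> \<in> \<Xi> \<Longrightarrow> prob_space \<nu>"
  and sets_eq: "\<nu> \<in> \<Xi> \<Longrightarrow> sets \<nu> = sets borel"
  using borel_prob by (auto simp: borel_prob_measures_def)

lemma space_eq: "\<nu> \<in> \<Xi> \<Longrightarrow> space \<nu> = UNIV"
  using sets_eq_imp_space_eq[OF sets_eq] by simp

lemma measure_le_of_subset:
  assumes "\<nu> \<in> \<Xi>" "A \<subseteq> B" "B \<in> sets borel"
  shows "measure \<nu> A \<le> measure \<nu> B"
proof -
  interpret prob_space \<nu> using prob assms by blast
  show ?thesis using assms by (intro finite_measure_mono) (auto simp: sets_eq)
qed

text \<open>The geometric weights \<open>e * (1/2) ^ Suc j\<close> add up to at most
  \<open>e\<close> whatever \<open>n\<close> is. This bookkeeping serves both places where countably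
  many approximations are combined with one tail \<open>B\<close>.\<close>

lemma measure_le_sum:
  assumes "\<nu> \<in> \<Xi>" "A \<subseteq> B \<union> (\<Union>j<n. C j)" "B \<in> sets borel" "\<And>j. C j \<in> sets borel"
    and "measure \<nu> B \<le> e" "\<And>j. measure \<nu> (C j) \<le> e * (1/2) ^ Suc j" "e > 0"
  shows "measure \<nu> A \<le> 2 * e"
proof -
  have "measure \<nu> A \<le> measure \<nu> (B \<union> (\<Union>j<n. C j))"
    using assms by (intro measure_le_of_subset) auto
  also have "\<dots> \<le> measure \<nu> B + measure \<nu> (\<Union>j<n. C j)"
    using assms by (intro measure_Un_le) (auto simp: sets_eq)
  also have "measure \<nu> (\<Union>j<n. C j) \<le> (\<Sum>j<n. measure \<nu> (C j))"
    using assms by (intro measure_UNION_le) (auto simp: sets_eq)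
  also have "\<dots> \<le> (\<Sum>j<n. e * (1/2) ^ Suc j)" using assms by (intro sum_mono) auto
  also have "\<dots> = e * (1 - (1/2) ^ n)" by (induction n) (auto simp: algebra_simps)
  also have "\<dots> \<le> e" using \<open>e > 0\<close> by (simp add: mult_le_cancel_left1)
  finally show ?thesis using assms(5) by simp
qed

text \<open>The sets with such approximations, uniform over \<open>\<Xi>\<close>, contain the open
  sets and are stable under complement and countable union, so induction over the generated
  sigma-algebra reaches every Borel set.\<close>

lemma uniformly_regular:
  assumes "A \<in> sets borel" "e > 0"
  shows "\<exists>K U. closed K \<and> open U \<and> K \<subseteq> A \<and> A \<subseteq> U \<and> (\<forall>\<nu>\<in>\<Xi>. measure \<nu> (U - K) \<le> e)"
proof -
  have "A \<in> sigma_sets UNIV {S. open S}" using assms(1) by (simp add: sets_borel)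
  then show ?thesis using \<open>e > 0\<close>
  proof (induction arbitrary: e)
    case (Basic U)
    then have "open U" by simp
    obtain K where K: "\<And>k::nat. closed (K k)" "incseq K" "(\<Union>k. interior (K k)) = U" "(\<Union>k. K k) = U"
      using open_eq_Union_interior_closed[OF \<open>open U\<close>] by blast
    have "incseq (\<lambda>k. interior (K k))"
      using K(2) by (auto simp: mono_def interior_mono)
    then obtain k where k: "\<forall>\<nu>\<in>\<Xi>. measure \<nu> (U - interior (K k)) \<le> e"
      using uniformly_open[of "\<lambda>k. interior (K k)" e] K Basic by auto
    have "measure \<nu> (U - K k) \<le> e" if "\<nu> \<in> \<Xi>" for \<nu>
    proof -
      have "measure \<nu> (U - K k) \<le> measure \<nu> (U - interior (K k))"
        using \<open>open U\<close> interior_subset[of "K k"] by (intro measure_le_of_subset[OF that]) auto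
      then show ?thesis using k that by force
    qed
    then show ?case using K(1)[of k] K(4) \<open>open U\<close> by (intro exI[of _ "K k"] exI[of _ U]) auto
  next
    case Empty
    then show ?case by (intro exI[of _ "{}"]) auto
  next
    case (Compl A)
    then obtain K U where KU: "closed K" "open U" "K \<subseteq> A" "A \<subseteq> U"
      "\<forall>\<nu>\<in>\<Xi>. measure \<nu> (U - K) \<le> e" by metis
    \<comment> \<open>Complementation exchanges the closed and the open approximant and leaves their
      difference unchanged.\<close>
    have "- K - - U = U - K" by auto
    with KU show ?case
      by (intro exI[of _ "-U"] exI[of _ "-K"]) (auto simp: open_Compl closed_Compl)
  next
    case (Union A)
    \<comment> \<open>One half of \<open>e\<close> pays for all the differences
      \<open>U j - K j\<close>, the other for the part of the union of the \<open>U j\<close>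
      outside \<open>W n\<close>. Cutting off at \<open>n\<close> keeps the inner set a finite
      union, hence closed.\<close>
    define d where "d = e / 2"
    have "d > 0" using Union by (simp add: d_def)
    then have "\<exists>K U. closed K \<and> open U \<and> K \<subseteq> A j \<and> A j \<subseteq> U \<and>
        (\<forall>\<nu>\<in>\<Xi>. measure \<nu> (U - K) \<le> d * (1/2) ^ Suc j)" for j
      by (intro Union.IH) simp
    then obtain K U where KU: "\<And>j. closed (K j)" "\<And>j. open (U j)" "\<And>j. K j \<subseteq> A j"
      "\<And>j. A j \<subseteq> U j" "\<And>j \<nu>. \<nu> \<in> \<Xi> \<Longrightarrow> measure \<nu> (U j - K j) \<le> d * (1/2) ^ Suc j"
      by metis
    define W where "W n = (\<Union>j<n. U j)" for n
    have W: "\<And>n. open (W n)" "incseq W" "(\<Union>n. W n) = (\<Union>j. U j)"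
      using KU(2) by (fastforce simp: W_def mono_def)+
    obtain n where n: "\<forall>\<nu>\<in>\<Xi>. measure \<nu> ((\<Union>j. U j) - W n) \<le> d"
      using uniformly_open[OF W(1,2) \<open>d > 0\<close>] W(3) by auto
    have "measure \<nu> ((\<Union>j. U j) - (\<Union>j<n. K j)) \<le> e" if "\<nu> \<in> \<Xi>" for \<nu>
    proof -
      have "measure \<nu> ((\<Union>j. U j) - (\<Union>j<n. K j)) \<le> 2 * d"
        using that n KU W \<open>d > 0\<close>
        by (intro measure_le_sum[where B = "(\<Union>j. U j) - W n" and C = "\<lambda>j. U j - K j" and n = n])
          (auto simp: W_def)
      then show ?thesis by (simp add: d_def)
    qed
    moreover have "closed (\<Union>j<n. K j)" "open (\<Union>j. U j)" using KU by auto
    moreover have "(\<Union>j<n. K j) \<subseteq> (\<Union>j. A j)" "(\<Union>j. A j) \<subseteq> (\<Union>j. U j)"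
      by (intro UN_mono KU(3,4) subset_UNIV)+
    ultimately show ?case
      by (intro exI[of _ "\<Union>j<n. K j"] exI[of _ "\<Union>j. U j"] conjI ballI)
  qed
qed

text \<open>Regularity extends the locale assumption from open to Borel sets. The open approximants
  \<open>U j\<close> of the \<open>A j\<close> need not increase, so the assumption is applied to
  their partial unions \<open>W n\<close>.\<close>

lemma uniformly_continuous_from_below:
  fixes A :: "nat \<Rightarrow> 'a set"
  assumes A: "\<And>k. A k \<in> sets borel" "incseq A" and "e > 0"
  shows "\<exists>n. \<forall>\<nu>\<in>\<Xi>. measure \<nu> ((\<Union>k. A k) - A n) \<le> e"
proof -
  define d where "d = e / 2"
  have "d > 0" using assms by (simp add: d_def)
  then have "\<exists>K U. closed K \<and> open U \<and> K \<subseteq> A j \<and> A j \<subseteq> U \<and>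
      (\<forall>\<nu>\<in>\<Xi>. measure \<nu> (U - K) \<le> d * (1/2) ^ Suc j)" for j
    using A(1) by (intro uniformly_regular) auto
  then obtain K U where KU: "\<And>j. closed (K j)" "\<And>j. open (U j)" "\<And>j. K j \<subseteq> A j"
    "\<And>j. A j \<subseteq> U j" "\<And>j \<nu>. \<nu> \<in> \<Xi> \<Longrightarrow> measure \<nu> (U j - K j) \<le> d * (1/2) ^ Suc j"
    by metis
  define W where "W n = (\<Union>j<n. U j)" for n
  have W: "\<And>n. open (W n)" "incseq W" "(\<Union>n. W n) = (\<Union>j. U j)"
    using KU(2) by (fastforce simp: W_def mono_def)+
  obtain n where n: "\<forall>\<nu>\<in>\<Xi>. measure \<nu> ((\<Union>j. U j) - W n) \<le> d"
    using uniformly_open[OF W(1,2) \<open>d > 0\<close>] W(3) by auto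
  have "measure \<nu> ((\<Union>k. A k) - A n) \<le> e" if "\<nu> \<in> \<Xi>" for \<nu>
  proof -
    \<comment> \<open>A point of \<open>W n\<close> outside \<open>A n\<close> lies in some
      \<open>U j\<close> with \<open>j < n\<close>, and it is not in \<open>K j\<close> because
      \<open>K j \<subseteq> A j \<subseteq> A n\<close>.\<close>
    have "(\<Union>k. A k) - A n \<subseteq> ((\<Union>j. U j) - W n) \<union> (\<Union>j<n. U j - K j)"
    proof
      fix x assume x: "x \<in> (\<Union>k. A k) - A n"
      show "x \<in> ((\<Union>j. U j) - W n) \<union> (\<Union>j<n. U j - K j)"
      proof (cases "x \<in> W n")
        case True
        then obtain j where j: "j < n" "x \<in> U j" by (auto simp: W_def)
        have "A j \<subseteq> A n" using A(2) j by (simp add: incseqD)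
        then show ?thesis using x j KU(3) by blast
      qed (use x KU(4) in blast)
    qed
    then have "measure \<nu> ((\<Union>k. A k) - A n) \<le> 2 * d"
      using that n KU W \<open>d > 0\<close> by (intro measure_le_sum) auto
    then show ?thesis by (simp add: d_def)
  qed
  then show ?thesis by blast
qed

text \<open>Finite additivity and total mass 1 pass to the pointwise limit at once. Countable
  additivity follows from continuity at the empty set, where the bound is uniform over
  \<open>\<Xi>\<close> and so survives the limit.\<close>

lemma setwise_limit:
  assumes \<nu>: "\<And>n. \<nu> n \<in> \<Xi>"
    and conv: "\<And>A. A \<in> sets borel \<Longrightarrow> convergent (\<lambda>n. measure (\<nu> n) A)"
  shows "\<exists>\<mu>\<in>borel_prob_measures. setwise_converges \<nu> \<mu>"
proof -
  define L where "L A = lim (\<lambda>n. measure (\<nu> n) A)" for A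
  have L: "(\<lambda>n. measure (\<nu> n) A) \<longlonglongrightarrow> L A" if "A \<in> sets borel" for A
    using conv[OF that] by (simp add: L_def convergent_LIMSEQ_iff)
  have L_nonneg: "0 \<le> L A" if "A \<in> sets borel" for A
    using L[OF that] by (rule LIMSEQ_le_const) auto
  have L_Un: "L (A \<union> B) = L A + L B"
    if "A \<in> sets borel" "B \<in> sets borel" "A \<inter> B = {}" for A B
  proof -
    have "measure (\<nu> n) (A \<union> B) = measure (\<nu> n) A + measure (\<nu> n) B" for n
    proof -
      interpret prob_space "\<nu> n" using prob \<nu> by blast
      show ?thesis using that sets_eq[OF \<nu>] by (intro finite_measure_Union) auto
    qed
    then have "(\<lambda>n. measure (\<nu> n) A + measure (\<nu> n) B) \<longlonglongrightarrow> L (A \<union> B)"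
      using L[of "A \<union> B"] that by auto
    then show ?thesis using that by (intro LIMSEQ_unique[OF _ tendsto_add[OF L L]]) auto
  qed
  have L_0: "L {} = 0" by (simp add: L_def)
  have L_UNIV: "L UNIV = 1"
  proof -
    have "measure (\<nu> n) UNIV = 1" for n
      using prob_space.prob_space[OF prob[OF \<nu>]] space_eq[OF \<nu>] by metis
    then show ?thesis by (simp add: L_def)
  qed
  define \<mu> where "\<mu> = measure_of UNIV (sets borel) (\<lambda>A. ennreal (L A))"
  have sets_\<mu>: "sets \<mu> = sets borel"
    unfolding \<mu>_def using sets.sigma_sets_eq[of "borel :: 'a measure"] by simp
  have pos: "positive (sets borel) (\<lambda>A. ennreal (L A))"
    by (simp add: positive_def L_0)
  have ca: "countably_additive (sets borel) (\<lambda>A. ennreal (L A))"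
  proof (rule sets.empty_continuous_imp_countably_additive[OF pos])
    show "additive (sets borel) (\<lambda>A. ennreal (L A))"
      by (auto simp: additive_def L_Un L_nonneg ennreal_plus)
    show "\<forall>A\<in>sets borel. ennreal (L A) \<noteq> \<infinity>" by simp
    fix A :: "nat \<Rightarrow> 'a set"
    assume A: "range A \<subseteq> sets borel" "decseq A" "(\<Inter>i. A i) = {}"
    have "(\<lambda>i. L (A i)) \<longlonglongrightarrow> 0"
    proof (rule LIMSEQ_I)
      fix e :: real assume "e > 0"
      \<comment> \<open>The complements of the \<open>A k\<close> increase to the whole space, which
        turns decrease to the empty set into continuity from below. The bound \<open>e / 2\<close>
        makes the final inequality strict after a limit that preserves only
        \<open>\<le>\<close>.\<close>
      have "\<exists>m. \<forall>\<nu>\<in>\<Xi>. measure \<nu> ((\<Union>k. - A k) - - A m) \<le> e / 2"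
        using A \<open>e > 0\<close> by (intro uniformly_continuous_from_below) (auto simp: decseq_def mono_def)
      moreover have "(\<Union>k. - A k) - - A m = A m" for m
        using A(3) by auto
      ultimately obtain m where m: "\<forall>\<nu>\<in>\<Xi>. measure \<nu> (A m) \<le> e / 2" by auto
      have "norm (L (A i) - 0) < e" if "i \<ge> m" for i
      proof -
        have "measure (\<nu> n) (A i) \<le> e / 2" for n
        proof -
          have "measure (\<nu> n) (A i) \<le> measure (\<nu> n) (A m)"
            using A(1) decseqD[OF A(2) that] by (intro measure_le_of_subset[OF \<nu>]) auto
          then show ?thesis using m \<nu>[of n] by force
        qed
        then have "L (A i) \<le> e / 2" using A by (intro LIMSEQ_le_const2[OF L]) auto
        then show ?thesis using L_nonneg[of "A i"] A \<open>e > 0\<close> by auto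
      qed
      then show "\<exists>m. \<forall>i\<ge>m. norm (L (A i) - 0) < e" by blast
    qed
    then show "(\<lambda>i. ennreal (L (A i))) \<longlonglongrightarrow> 0"
      using tendsto_ennrealI by force
  qed
  have \<mu>: "emeasure \<mu> A = ennreal (L A)" if "A \<in> sets borel" for A
    using that pos ca sets.sigma_algebra_axioms[of "borel :: 'a measure"] unfolding \<mu>_def
    by (intro emeasure_measure_of_sigma) auto
  have "space \<mu> = UNIV" using sets_eq_imp_space_eq[OF sets_\<mu>] by simp
  then have "prob_space \<mu>" by (intro prob_spaceI) (simp add: \<mu> L_UNIV)
  moreover have "setwise_converges \<nu> \<mu>"
    unfolding setwise_converges_def
  proof
    fix A :: "'a set" assume A: "A \<in> sets borel"
    have "emeasure (\<nu> n) A = ennreal (measure (\<nu> n) A)" for n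
      using prob[OF \<nu>] by (intro finite_measure.emeasure_eq_measure) (simp add: prob_space_def)
    then show "(\<lambda>n. emeasure (\<nu> n) A) \<longlonglongrightarrow> emeasure \<mu> A"
      using L[OF A] by (simp add: \<mu> A tendsto_ennrealI)
  qed
  ultimately show ?thesis using sets_\<mu> by (auto simp: borel_prob_measures_def)
qed

text \<open>Diagonalization yields convergence on the countable class \<open>\<B>\<close>. Each
  Borel set is approximated by a member of \<open>\<B>\<close> uniformly over \<open>\<Xi>\<close>,
  so convergence spreads to all Borel sets and \<open>setwise_limit\<close> applies.\<close>

lemma relatively_compact:
  assumes "compact (UNIV :: 'a set)"
  shows "setwise_relatively_compact \<Xi>"
  unfolding setwise_relatively_compact_def
proof (intro allI impI)
  fix \<nu> :: "nat \<Rightarrow> 'a measure" assume "\<forall>n. \<nu> n \<in> \<Xi>"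
  then have \<nu>: "\<nu> n \<in> \<Xi>" for n by blast
  obtain \<B> :: "'a set set" where \<B>: "countable \<B>" "\<And>B. B \<in> \<B> \<Longrightarrow> open B"
    "\<And>K U. closed K \<Longrightarrow> open U \<Longrightarrow> K \<subseteq> U \<Longrightarrow> \<exists>B\<in>\<B>. K \<subseteq> B \<and> B \<subseteq> U"
    by (rule compact_space_countable_base_interpolates[OF assms]) (use that in blast)
  obtain r where r: "strict_mono r" "\<And>B. B \<in> \<B> \<Longrightarrow> convergent (\<lambda>i. measure (\<nu> (r i)) B)"
    by (rule measures_convergent_subsequence[of \<nu>, OF prob[OF \<nu>] \<B>(1)]) (use that in blast)
  have "convergent (\<lambda>i. measure (\<nu> (r i)) A)" if A: "A \<in> sets borel" for A
  proof (rule Cauchy_convergent, rule metric_CauchyI)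
    fix e :: real assume "e > 0"
    then obtain K U where KU: "closed K" "open U" "K \<subseteq> A" "A \<subseteq> U"
      "\<And>\<nu>. \<nu> \<in> \<Xi> \<Longrightarrow> measure \<nu> (U - K) \<le> e / 4"
      using uniformly_regular[OF A, of "e / 4"] by auto
    obtain B where B: "B \<in> \<B>" "K \<subseteq> B" "B \<subseteq> U" using \<B>(3)[of K U] KU by blast
    \<comment> \<open>Both \<open>A\<close> and \<open>B\<close> lie between \<open>K\<close> and
      \<open>U\<close>, so their measures differ by at most that of \<open>U - K\<close>. Two such
      errors of \<open>e / 4\<close> and the Cauchy bound \<open>e / 2\<close> for \<open>B\<close>
      stay below \<open>e\<close>.\<close>
    have close: "\<bar>measure (\<nu> n) A - measure (\<nu> n) B\<bar> \<le> e / 4" for n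
    proof -
      interpret prob_space "\<nu> n" using prob \<nu> by blast
      have "measure (\<nu> n) (U - K) = measure (\<nu> n) U - measure (\<nu> n) K"
        using KU sets_eq[OF \<nu>] by (intro finite_measure_Diff) auto
      moreover have "measure (\<nu> n) K \<le> measure (\<nu> n) A" "measure (\<nu> n) A \<le> measure (\<nu> n) U"
        "measure (\<nu> n) K \<le> measure (\<nu> n) B" "measure (\<nu> n) B \<le> measure (\<nu> n) U"
        using KU B \<B>(2)[OF B(1)] A by (auto intro!: measure_le_of_subset[OF \<nu>])
      ultimately show ?thesis using KU(5)[OF \<nu>, of n] by linarith
    qed
    have "Cauchy (\<lambda>i. measure (\<nu> (r i)) B)" using r(2)[OF B(1)] by (rule convergent_Cauchy)
    then obtain M where M: "\<And>m n. m \<ge> M \<Longrightarrow> n \<ge> M \<Longrightarrow>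
        dist (measure (\<nu> (r m)) B) (measure (\<nu> (r n)) B) < e / 2"
      using \<open>e > 0\<close> unfolding Cauchy_def by (meson half_gt_zero)
    have "dist (measure (\<nu> (r m)) A) (measure (\<nu> (r n)) A) < e" if "m \<ge> M" "n \<ge> M" for m n
      using M[OF that] close[of "r m"] close[of "r n"] unfolding dist_real_def by linarith
    then show "\<exists>M. \<forall>m\<ge>M. \<forall>n\<ge>M. dist (measure (\<nu> (r m)) A) (measure (\<nu> (r n)) A) < e" by blast
  qed
  then have "\<exists>\<mu>\<in>borel_prob_measures. setwise_converges (\<lambda>i. \<nu> (r i)) \<mu>"
    using \<nu> by (intro setwise_limit)
  then show "\<exists>r. strict_mono r \<and> (\<exists>\<mu>\<in>borel_prob_measures. setwise_converges (\<lambda>i. \<nu> (r i)) \<mu>)"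
    using r(1) by blast
qed

end

section \<open>The upper limit condition\<close>

text \<open>This is the equation demanded of the chosen subsequence, separated from the choice so
  that it can be studied for one sequence.\<close>

definition limsup_inner_regular :: "(nat \<Rightarrow> 'a::topological_space measure) \<Rightarrow> bool" where
  "limsup_inner_regular \<nu> \<longleftrightarrow> (\<forall>U. open U \<longrightarrow>
     limsup (\<lambda>i. emeasure (\<nu> i) U) =
       (SUP K\<in>{K. closed K \<and> K \<subseteq> U}. limsup (\<lambda>i. emeasure (\<nu> i) K)))"

text \<open>Under setwise convergence every upper limit is the value of \<open>\<mu>\<close>, and
  the claim becomes inner regularity of \<open>\<mu>\<close> on open sets, obtained from a closed
  exhaustion and continuity from below.\<close>

lemma setwise_converges_imp_limsup_inner_regular:
  fixes \<mu> :: "'a::metric_space measure"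
  assumes "\<mu> \<in> borel_prob_measures" "setwise_converges \<nu> \<mu>"
  shows "limsup_inner_regular \<nu>"
  unfolding limsup_inner_regular_def
proof (intro allI impI)
  fix U :: "'a set" assume "open U"
  have lim: "limsup (\<lambda>i. emeasure (\<nu> i) A) = emeasure \<mu> A" if "A \<in> sets borel" for A
    using assms(2) that by (intro lim_imp_Limsup) (auto simp: setwise_converges_def)
  have sets: "sets \<mu> = sets borel" using assms(1) by (simp add: borel_prob_measures_def)
  obtain K where K: "\<And>k::nat. closed (K k)" "incseq K" "(\<Union>k. K k) = U"
    by (rule open_eq_Union_interior_closed[OF \<open>open U\<close>]) (use that in blast)
  have "emeasure \<mu> U = (SUP k. emeasure \<mu> (K k))"
    using SUP_emeasure_incseq[of K \<mu>] K sets by (simp add: image_subset_iff)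
  also have "\<dots> \<le> (SUP K\<in>{K. closed K \<and> K \<subseteq> U}. emeasure \<mu> K)"
    using K by (intro SUP_mono) blast
  finally have "emeasure \<mu> U = (SUP K\<in>{K. closed K \<and> K \<subseteq> U}. emeasure \<mu> K)"
    using \<open>open U\<close> sets by (intro antisym SUP_least) (auto intro!: emeasure_mono)
  then show "limsup (\<lambda>i. emeasure (\<nu> i) U) =
      (SUP K\<in>{K. closed K \<and> K \<subseteq> U}. limsup (\<lambda>i. emeasure (\<nu> i) K))"
    using \<open>open U\<close> by (simp add: lim cong: SUP_cong_simp)
qed

text \<open>Mass at least \<open>e\<close> stays outside \<open>U i\<close> at time
  \<open>i\<close>, so it eventually leaves every closed subset of the union \<open>V\<close>. The
  upper limits over such subsets remain \<open>e\<close> below that of \<open>V\<close>, contrary to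
  inner regularity.\<close>

lemma limsup_inner_regular_no_escape:
  fixes \<nu> :: "nat \<Rightarrow> 'a::metric_space measure"
  assumes compact: "compact (UNIV :: 'a set)"
    and \<nu>: "\<And>n. \<nu> n \<in> borel_prob_measures"
    and reg: "limsup_inner_regular \<nu>"
    and U: "\<And>k. open (U k)" "incseq U"
    and conv: "\<And>m. convergent (\<lambda>i. measure (\<nu> i) (U m))"
    and escape: "\<And>i. e \<le> measure (\<nu> i) ((\<Union>k. U k) - U i)" and "e > 0"
  shows False
proof -
  define V where "V = (\<Union>k. U k)"
  define \<phi> where "\<phi> A = limsup (\<lambda>i. emeasure (\<nu> i) A)" for A
  have prob: "prob_space (\<nu> n)" and sets: "sets (\<nu> n) = sets borel" for n
    using \<nu> by (auto simp: borel_prob_measures_def)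
  have emeasure_eq: "emeasure (\<nu> n) A = ennreal (measure (\<nu> n) A)" for n A
    using prob by (intro finite_measure.emeasure_eq_measure) (simp add: prob_space_def)
  have open_V: "open V" using U by (auto simp: V_def)
  have gap: "\<phi> K + ennreal e \<le> \<phi> V" if K: "closed K" "K \<subseteq> V" for K
  proof -
    have "compact K" using K(1) compact by (metis compact_Int_closed inf_top_left)
    then obtain m where m: "K \<subseteq> U m"
      using compact_subset_incseq_open[of K U] U K(2) by (auto simp: V_def)
    obtain a where a: "(\<lambda>i. measure (\<nu> i) (U m)) \<longlonglongrightarrow> a"
      using conv by (auto simp: convergent_def)
    have "a \<ge> 0" using a by (rule LIMSEQ_le_const) auto
    have "\<phi> K \<le> \<phi> (U m)"
      unfolding \<phi>_def using m U sets by (intro Limsup_mono always_eventually allI emeasure_mono) auto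
    also have "\<phi> (U m) = ennreal a"
      unfolding \<phi>_def using a by (intro lim_imp_Limsup) (auto simp: emeasure_eq intro: tendsto_ennrealI)
    finally have "\<phi> K + ennreal e \<le> ennreal (a + e)"
      using \<open>a \<ge> 0\<close> \<open>e > 0\<close> by (simp add: ennreal_plus add_right_mono)
    also have "\<dots> = limsup (\<lambda>i. ennreal (measure (\<nu> i) (U m) + e))"
      using a by (intro lim_imp_Limsup[symmetric]) (auto intro!: tendsto_intros)
    also have "\<dots> \<le> \<phi> V"
      unfolding \<phi>_def
    proof (intro Limsup_mono eventually_sequentiallyI[of m])
      fix i assume "m \<le> i"
      interpret prob_space "\<nu> i" by (rule prob)
      \<comment> \<open>For \<open>i\<close> beyond \<open>m\<close> the set \<open>U i\<close>
        contains \<open>U m\<close> and is disjoint from the escaping part \<open>V - U i\<close>.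
        Convergence on \<open>U m\<close> is what lets \<open>e\<close> be added inside the upper
        limit.\<close>
      have "measure (\<nu> i) (U m) + e \<le> measure (\<nu> i) (U i) + measure (\<nu> i) (V - U i)"
        using escape[of i] \<open>m \<le> i\<close> U sets by (intro add_mono finite_measure_mono) (auto simp: V_def incseqD)
      also have "\<dots> = measure (\<nu> i) (U i \<union> (V - U i))"
        using U open_V sets by (intro finite_measure_Union[symmetric]) auto
      also have "U i \<union> (V - U i) = V" by (auto simp: V_def)
      finally show "ennreal (measure (\<nu> i) (U m) + e) \<le> emeasure (\<nu> i) V"
        by (simp add: emeasure_eq ennreal_leI)
    qed
    finally show ?thesis .
  qed
  have "\<phi> V = (SUP K\<in>{K. closed K \<and> K \<subseteq> V}. \<phi> K)"
    using reg open_V by (simp add: limsup_inner_regular_def \<phi>_def)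
  also have "\<dots> \<le> \<phi> V - ennreal e"
    using gap by (intro SUP_least) (auto simp: ennreal_le_minus_iff)
  finally have "\<phi> V \<le> \<phi> V - ennreal e" .
  moreover have "\<phi> V \<le> 1"
    unfolding \<phi>_def using prob_space.emeasure_le_1[OF prob]
    by (intro Limsup_bounded always_eventually) auto
  \<comment> \<open>Subtraction in \<open>ennreal\<close> is truncated at 0 and fixes infinity. The
    gap at the empty set rules out truncation and the bound 1 rules out infinity, so the inequality
    above is a real contradiction.\<close>
  moreover have "ennreal e \<le> \<phi> V" using gap[of "{}"] by (auto simp: \<phi>_def Limsup_const)
  ultimately show False
    using \<open>e > 0\<close> by (cases "\<phi> V") (auto simp: ennreal_minus top_unique)
qed

text \<open>A failure of uniformity selects one bad measure for each index. Thinning first by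
  \<open>s\<close>, for convergence on all \<open>U m\<close>, and then by \<open>r\<close>, for
  inner regularity, produces the sequence excluded by
  \<open>limsup_inner_regular_no_escape\<close>.\<close>

lemma limsup_inner_regular_imp_uniformly_open_continuous:
  fixes \<Xi> :: "'a::metric_space measure set"
  assumes compact: "compact (UNIV :: 'a set)" and \<Xi>: "\<Xi> \<subseteq> borel_prob_measures"
    and reg: "\<And>\<nu>. (\<And>n. \<nu> n \<in> \<Xi>) \<Longrightarrow>
      \<exists>r :: nat \<Rightarrow> nat. strict_mono r \<and> limsup_inner_regular (\<lambda>i. \<nu> (r i))"
  shows "uniformly_open_continuous \<Xi>"
proof (unfold_locales, rule \<Xi>, rule ccontr)
  fix U :: "nat \<Rightarrow> 'a set" and e :: real
  assume U: "\<And>k. open (U k)" "incseq U" and "0 < e"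
    and "\<not> (\<exists>k. \<forall>\<nu>\<in>\<Xi>. measure \<nu> ((\<Union>k. U k) - U k) \<le> e)"
  then obtain \<nu> where \<nu>: "\<And>k. \<nu> k \<in> \<Xi>" "\<And>k. measure (\<nu> k) ((\<Union>k. U k) - U k) > e"
    by (metis linorder_not_le)
  have prob: "prob_space (\<nu> n)" and sets: "sets (\<nu> n) = sets borel" for n
    using \<nu> \<Xi> by (auto simp: borel_prob_measures_def)
  obtain s where s: "strict_mono s" "\<And>m. convergent (\<lambda>i. measure (\<nu> (s i)) (U m))"
    by (rule measures_convergent_subsequence[of \<nu> "range U", OF prob]) auto
  obtain r where r: "strict_mono r" "limsup_inner_regular (\<lambda>i. \<nu> (s (r i)))"
    using reg[of "\<lambda>i. \<nu> (s i)"] \<nu> by auto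
  show False
  proof (rule limsup_inner_regular_no_escape[OF compact _ r(2) U _ _ \<open>0 < e\<close>])
    show "\<nu> (s (r n)) \<in> borel_prob_measures" for n using \<nu> \<Xi> by blast
    show "convergent (\<lambda>i. measure (\<nu> (s (r i))) (U m))" for m
      using convergent_subseq_convergent[OF s(2) r(1)] by (simp add: o_def)
    fix i
    \<comment> \<open>The escape bound is known at index \<open>s (r i)\<close> but required at
      \<open>i\<close>. Since \<open>U i\<close> is contained in \<open>U (s (r i))\<close>,
      removing it leaves at least as much mass.\<close>
    have "i \<le> s (r i)" using s(1) r(1) by (meson order_trans strict_mono_imp_increasing)
    then have sub: "(\<Union>k. U k) - U (s (r i)) \<subseteq> (\<Union>k. U k) - U i"
      using U(2) by (auto dest: incseqD)
    interpret prob_space "\<nu> (s (r i))" by (rule prob)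
    have "measure (\<nu> (s (r i))) ((\<Union>k. U k) - U (s (r i))) \<le> measure (\<nu> (s (r i))) ((\<Union>k. U k) - U i)"
      using sub U sets by (intro finite_measure_mono) auto
    then show "e \<le> measure (\<nu> (s (r i))) ((\<Union>k. U k) - U i)"
      using \<nu>(2)[of "s (r i)"] by linarith
  qed
qed

theorem theorem2p15:
  fixes \<Xi> :: "'a::metric_space measure set"
  assumes "compact (UNIV :: 'a set)"
    and "\<Xi> \<subseteq> borel_prob_measures"
  shows "setwise_relatively_compact \<Xi> \<longleftrightarrow>
    (\<forall>\<nu>. (\<forall>n. \<nu> n \<in> \<Xi>) \<longrightarrow>
      (\<exists>r :: nat \<Rightarrow> nat. strict_mono r \<and>
        (\<forall>U. open U \<longrightarrow>
          limsup (\<lambda>i. emeasure (\<nu> (r i)) U) =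
            (SUP K\<in>{K. closed K \<and> K \<subseteq> U}. limsup (\<lambda>i. emeasure (\<nu> (r i)) K)))))"
proof -
  have "setwise_relatively_compact \<Xi> \<longleftrightarrow> (\<forall>\<nu>. (\<forall>n. \<nu> n \<in> \<Xi>) \<longrightarrow>
      (\<exists>r :: nat \<Rightarrow> nat. strict_mono r \<and> limsup_inner_regular (\<lambda>i. \<nu> (r i))))"
    (is "_ \<longleftrightarrow> ?reg")
  proof
    assume "setwise_relatively_compact \<Xi>"
    then show ?reg
      unfolding setwise_relatively_compact_def
      using setwise_converges_imp_limsup_inner_regular by fast
  next
    assume ?reg
    then interpret uniformly_open_continuous \<Xi>
      by (intro limsup_inner_regular_imp_uniformly_open_continuous assms) blast
    show "setwise_relatively_compact \<Xi>" by (rule relatively_compact[OF assms(1)])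
  qed
  then show ?thesis unfolding limsup_inner_regular_def .
qed

end
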